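(* $R^{\mathrm{KG}}_2(3,3)=9$ and $R^{\mathrm{KG}}_3(3,3)\le 13$.
   Context: The Kneser graph $\mathrm{KG}(n,r)$ has vertex set the $r$-element subsets of $[n]=\{1,\dots,n\}$, with two sets adjacent iff they are disjoint. The $r$-Kneser Ramsey number $R^{\mathrm{KG}}_r(s,t)$ is the minimum integer $n$ such that every red/blue edge-coloring of $\mathrm{KG}(n,r)$ contains a red $K_s$ (a set of $s$ pairwise adjacent vertices with all connecting edges red) or a blue $K_t$. In particular, $R^{\mathrm{KG}}_r(3,3)$ is the least $n$ such that every red/blue edge-coloring of $\mathrm{KG}(n,r)$ has a monochromatic triangle. *)

theory Defs
  imports Main "HOL-Library.Ramsey"
begin

definition kneser_verts :: "nat \<Rightarrow> nat \<Rightarrow> nat set set" where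
  "kneser_verts n r = nsets {1..n} r"

text \<open>Undirected edges are two-element sets of vertices. The condition \<open>A \<noteq> B\<close>, which excludes
  loops, only matters when \<open>r = 0\<close>.\<close>

definition kneser_edges :: "nat \<Rightarrow> nat \<Rightarrow> nat set set set" where
  "kneser_edges n r =
     {{A, B} | A B. A \<in> kneser_verts n r \<and> B \<in> kneser_verts n r \<and> A \<noteq> B \<and> A \<inter> B = {}}"

datatype colour = Red | Blue

text \<open>Colourings are total functions; the values outside the edge set \<open>E\<close> are irrelevant.\<close>

definition has_mono_clique ::
    "'a set \<Rightarrow> 'a set set \<Rightarrow> ('a set \<Rightarrow> colour) \<Rightarrow> colour \<Rightarrow> nat \<Rightarrow> bool" where
  "has_mono_clique V E c k s \<longleftrightarrow>
     (\<exists>K \<subseteq> V. finite K \<and> card K = s \<and> clique K {e \<in> E. c e = k})"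

definition kneser_arrows :: "nat \<Rightarrow> nat \<Rightarrow> nat \<Rightarrow> nat \<Rightarrow> bool" where
  "kneser_arrows n r s t \<longleftrightarrow>
     (\<forall>c :: nat set set \<Rightarrow> colour.
        has_mono_clique (kneser_verts n r) (kneser_edges n r) c Red s \<or>
        has_mono_clique (kneser_verts n r) (kneser_edges n r) c Blue t)"

definition kneser_ramsey :: "nat \<Rightarrow> nat \<Rightarrow> nat \<Rightarrow> nat" where
  "kneser_ramsey r s t = (LEAST n. kneser_arrows n r s t)"

end

(*
Fix the vertex P = {1..r} of KG(4r+1, r). A colouring without monochromatic triangle two-colours
the r-subsets of the remaining 3r+1 points (the link of P) so that no three pairwise disjoint sets
get the same colour, and an edge inside the link joining two sets of equal colour must have the
other colour. The edges between a red set A and a blue set B are then governed by implications: if AB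
is red and B' is blue and disjoint from both, then AB' is blue; if AB' is blue and A' is red and
disjoint from both, then A'B' is red. Contradictory cycles of such implications exist as soon as the
link colouring is known well enough.

Take E with |E| = r-1 and points u, v such that E+u is red and E+v is blue. On the remaining 2r points
W complementary r-sets have different colours. For r = 2 this makes the colouring of W a dictatorship
of one point; for r = 3 it must be a dictatorship or the majority colouring of a 3-set T in W. A
dictatorship yields 2r points whose r-subsets all have the same colour (two_point). In the majority
case the colouring of the 10 points of the link is essentially "at least two elements in a fixed
5-set", and the implication cycle of five_five_chain applies to it and to its colour swap.

For KG(8, 2), split the points into {1,2,3} and a directed pentagon on {4..8}. A pair inside {1,2,3}
is joined in red to the pairs inside the pentagon, a mixed pair {t,x} to the pairs containing the
successor of x; all other edges are blue.
*)
theory Submission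
  imports Defs
begin

section \<open>Exchanges and small finite sets\<close>

text \<open>Swapping an element of \<open>A - B\<close> for one of \<open>B - A\<close> lowers
  \<open>card (B - A)\<close> by one, until \<open>A = B\<close>.\<close>

lemma nsets_exchange_induct:
  assumes A: "A \<in> nsets S r" and B: "B \<in> nsets S r" and PA: "P A"
    and step: "\<And>A a b. \<lbrakk>A \<in> nsets S r; P A; a \<in> A; b \<in> S; b \<notin> A\<rbrakk> \<Longrightarrow> P (insert b (A - {a}))"
  shows "P B"
  using A PA
proof (induction "card (B - A)" arbitrary: A)
  case 0
  with B have "B \<subseteq> A" "card A = card B" "finite A" "finite B"
    by (auto simp: nsets_def)
  then have "B = A" by (simp add: card_subset_eq)
  with 0 show ?case by simp
next
  case (Suc k)
  have fin: "finite A" "finite B" "card A = card B"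
    using Suc.prems B by (auto simp: nsets_def)
  from Suc.hyps(2) have "B - A \<noteq> {}" by (metis card.empty nat.distinct(1))
  then obtain b where b: "b \<in> B" "b \<notin> A" by blast
  have "card (A - B) = card (B - A)"
    using fin by (simp add: card_le_sym_Diff antisym)
  with Suc.hyps(2) have "A - B \<noteq> {}" by (metis card.empty nat.distinct(1))
  then obtain a where a: "a \<in> A" "a \<notin> B" by blast
  let ?A = "insert b (A - {a})"
  have bS: "b \<in> S" using B b by (auto simp: nsets_def)
  have "?A \<in> nsets S r"
    using Suc.prems(1) a b bS fin by (auto simp: nsets_def card_Suc_Diff1 simp del: card_Diff_insert card_Diff_singleton)
  moreover have "P ?A" using step Suc.prems a b bS by blast
  moreover have "B - A = insert b (B - ?A)" "b \<notin> B - ?A" using a b by auto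
  then have "k = card (B - ?A)"
    using Suc.hyps(2) fin by (metis Suc_inject card_insert_disjoint finite_Diff)
  ultimately show ?case using Suc.hyps(1) by blast
qed

lemma nsets_subset: "A \<in> nsets S k \<Longrightarrow> A \<subseteq> S"
  by (simp add: nsets_def)

lemma mem_nsets: "{i, j} \<in> nsets S 2 \<longleftrightarrow> i \<in> S \<and> j \<in> S \<and> i \<noteq> j"
  "{i, j, k} \<in> nsets S 3 \<longleftrightarrow> i \<in> S \<and> j \<in> S \<and> k \<in> S \<and> i \<noteq> j \<and> i \<noteq> k \<and> j \<noteq> k"
  by (auto simp: nsets_def card_insert_if)

lemma nsets_nonempty: "\<lbrakk>A \<in> nsets S k; 0 < k\<rbrakk> \<Longrightarrow> A \<noteq> {}"
  by (auto simp: nsets_def)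

lemma ex_nsets: "\<lbrakk>finite S; k \<le> card S\<rbrakk> \<Longrightarrow> \<exists>A. A \<in> nsets S k"
  using obtain_subset_with_card_n[of k S] by (auto simp: nsets_def intro: finite_subset)

lemma distinct_six:
  assumes "card W = 6"
  obtains a b c d e g where "W = {a, b, c, d, e, g}" "distinct [a, b, c, d, e, g]"
proof -
  have "finite W" using assms by (intro card_ge_0_finite) simp
  then obtain xs where xs: "set xs = W" "distinct xs" using finite_distinct_list by blast
  with assms have "length xs = Suc (Suc (Suc (Suc (Suc (Suc 0)))))" by (simp add: distinct_card[symmetric])
  then obtain a b c d e g where "xs = [a, b, c, d, e, g]" by (auto simp: length_Suc_conv)
  with xs that show thesis by auto
qed

text \<open>A propositional problem in the colours of the 20 triples and the 6 values of
  \<open>t\<close>. It matters that one \<open>t\<close> serves all pairs \<open>D\<close>; in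
  \<open>majority\<close> it maps \<open>n\<close> to \<open>f (insert n E)\<close>. As
  \<open>dict\<close> excludes dictatorships, only the majority colouring of \<open>T\<close>
  survives.\<close>

lemma six_point:
  fixes f :: "'a set \<Rightarrow> bool" and t :: "'a \<Rightarrow> bool"
  assumes W: "card W = 6"
    and anti: "\<And>S. S \<in> nsets W 3 \<Longrightarrow> f (W - S) = (\<not> f S)"
    and pair: "\<And>D. D \<in> nsets W 2 \<Longrightarrow>
      (\<exists>k. \<forall>n\<in>W - D. f (insert n D) = k) \<or> (\<forall>n\<in>W - D. f (insert n D) = t n)"
    and dict: "\<And>a k. a \<in> W \<Longrightarrow> \<exists>D\<in>nsets (W - {a}) 2. f (insert a D) \<noteq> k"
  shows "\<exists>T\<in>nsets W 3. \<forall>D\<in>nsets T 2. \<forall>n\<in>W - D. f (insert n D)"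
proof (rule ccontr)
  obtain a b c d e g where We: "W = {a, b, c, d, e, g}" and dist: "distinct [a, b, c, d, e, g]"
    using distinct_six[OF W] .
  have ne:
    "a \<noteq> b" "a \<noteq> c" "a \<noteq> d" "a \<noteq> e" "a \<noteq> g"
    "b \<noteq> a" "b \<noteq> c" "b \<noteq> d" "b \<noteq> e" "b \<noteq> g"
    "c \<noteq> a" "c \<noteq> b" "c \<noteq> d" "c \<noteq> e" "c \<noteq> g"
    "d \<noteq> a" "d \<noteq> b" "d \<noteq> c" "d \<noteq> e" "d \<noteq> g"
    "e \<noteq> a" "e \<noteq> b" "e \<noteq> c" "e \<noteq> d" "e \<noteq> g"
    "g \<noteq> a" "g \<noteq> b" "g \<noteq> c" "g \<noteq> d" "g \<noteq> e"
    using dist by auto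
  assume neg: "\<not> ?thesis"
  have 1: "S \<in> nsets W 3 \<longrightarrow> f (W - S) = (\<not> f S)" for S using anti by blast
  have 2: "D \<in> nsets W 2 \<longrightarrow>
      (\<forall>n\<in>W - D. f (insert n D)) \<or> (\<forall>n\<in>W - D. \<not> f (insert n D)) \<or> (\<forall>n\<in>W - D. f (insert n D) = t n)"
    for D using pair by blast
  \<comment> \<open>The equation for \<open>V\<close> lets each instance supply an explicit
    five-element set, over which the quantifiers can be expanded.\<close>
  have 3: "W - {a} = V \<longrightarrow> a \<in> W \<longrightarrow>
      (\<exists>D\<in>nsets V 2. f (insert a D)) \<and> (\<exists>D\<in>nsets V 2. \<not> f (insert a D))" for a V
    using dict by blast
  have 4: "T \<in> nsets W 3 \<longrightarrow> (\<exists>D\<in>nsets T 2. \<exists>n\<in>W - D. \<not> f (insert n D))" for T using neg by blast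
  \<comment> \<open>One triple from each complementary pair suffices, hence only those containing
    \<open>a\<close>.\<close>
  note anti_facts =
    1[of "{a, b, c}"] 1[of "{a, b, d}"] 1[of "{a, b, e}"] 1[of "{a, b, g}"] 1[of "{a, c, d}"]
    1[of "{a, c, e}"] 1[of "{a, c, g}"] 1[of "{a, d, e}"] 1[of "{a, d, g}"] 1[of "{a, e, g}"]
  note pair_facts =
    2[of "{a, b}"] 2[of "{a, c}"] 2[of "{a, d}"] 2[of "{a, e}"] 2[of "{a, g}"] 2[of "{b, c}"]
    2[of "{b, d}"] 2[of "{b, e}"] 2[of "{b, g}"] 2[of "{c, d}"] 2[of "{c, e}"] 2[of "{c, g}"]
    2[of "{d, e}"] 2[of "{d, g}"] 2[of "{e, g}"]
  note maj_facts =
    4[of "{a, b, c}"] 4[of "{a, b, d}"] 4[of "{a, b, e}"] 4[of "{a, b, g}"] 4[of "{a, c, d}"]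
    4[of "{a, c, e}"] 4[of "{a, c, g}"] 4[of "{a, d, e}"] 4[of "{a, d, g}"] 4[of "{a, e, g}"]
    4[of "{b, c, d}"] 4[of "{b, c, e}"] 4[of "{b, c, g}"] 4[of "{b, d, e}"] 4[of "{b, d, g}"]
    4[of "{b, e, g}"] 4[of "{c, d, e}"] 4[of "{c, d, g}"] 4[of "{c, e, g}"] 4[of "{d, e, g}"]
  note dict_facts =
    3[of a "{b, c, d, e, g}"] 3[of b "{a, c, d, e, g}"] 3[of c "{a, b, d, e, g}"]
    3[of d "{a, b, c, e, g}"] 3[of e "{a, b, c, d, g}"] 3[of g "{a, b, c, d, e}"]
  \<comment> \<open>\<open>insert_commute\<close> brings every triple into a normal form, so that
    equal sets become the same atom for \<open>sat\<close>.\<close>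
  show False
    using anti_facts pair_facts dict_facts maj_facts
    by (simp (no_asm_use) add: We ne mem_nsets nsets_2_eq insert_Diff_if insert_commute) sat
qed

section \<open>The link of a fixed vertex\<close>

text \<open>\<open>True\<close> means red: \<open>f A\<close> is the colour of the edge from the
  fixed vertex to \<open>A\<close>, and \<open>c A B\<close> that of an edge inside the link.
  \<open>cone\<close> excludes monochromatic triangles through the fixed vertex,
  \<open>triangle\<close> those inside the link.\<close>

locale cone_colouring =
  fixes X :: "'a set" and r :: nat and f :: "'a set \<Rightarrow> bool" and c :: "'a set \<Rightarrow> 'a set \<Rightarrow> bool"
  assumes r: "2 \<le> r"
    and c_sym: "c A B = c B A"
    and cone: "\<lbrakk>A \<in> nsets X r; B \<in> nsets X r; A \<inter> B = {}; f A = f B\<rbrakk> \<Longrightarrow> c A B = (\<not> f A)"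
    and triangle: "\<lbrakk>A \<in> nsets X r; B \<in> nsets X r; C \<in> nsets X r; A \<inter> B = {}; B \<inter> C = {}; A \<inter> C = {}\<rbrakk>
      \<Longrightarrow> \<not> (c A B = c B C \<and> c B C = c A C)"
begin

lemma swap: "cone_colouring X r (\<lambda>A. \<not> f A) (\<lambda>A B. \<not> c A B)"
  using r c_sym cone triangle by unfold_locales blast+

text \<open>By \<open>cone\<close> all three edges would have the colour opposite to
  \<open>f A\<close>.\<close>

lemma link_no_mono:
  assumes "A \<in> nsets X r" "B \<in> nsets X r" "C \<in> nsets X r"
    "A \<inter> B = {}" "B \<inter> C = {}" "A \<inter> C = {}" "f A = f B" "f B = f C"
  shows False
  using assms cone triangle by metis

text \<open>If \<open>C\<close> and \<open>D\<close> had equal colour, one of \<open>A\<close> and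
  \<open>B\<close> would share it and complete a disjoint triple of one colour. \<open>A\<close> and
  \<open>B\<close> may intersect.\<close>

lemma antipodal:
  assumes "A \<in> nsets X r" "B \<in> nsets X r" "C \<in> nsets X r" "D \<in> nsets X r" "f A \<noteq> f B"
    "C \<inter> D = {}" "A \<inter> C = {}" "A \<inter> D = {}" "B \<inter> C = {}" "B \<inter> D = {}"
  shows "f D = (\<not> f C)"
  using assms link_no_mono[of A C D] link_no_mono[of B C D] by blast

text \<open>The edge between the blue sets \<open>B\<close> and \<open>C\<close> is red, so two
  further red edges would close a triangle.\<close>

lemma red_edge_step:
  assumes "A \<in> nsets X r" "B \<in> nsets X r" "C \<in> nsets X r"
    "A \<inter> B = {}" "B \<inter> C = {}" "A \<inter> C = {}" "\<not> f B" "\<not> f C" "c A B"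
  shows "\<not> c A C"
  using assms cone[of B C] triangle[of A B C] by blast

lemma blue_edge_step:
  assumes "A \<in> nsets X r" "B \<in> nsets X r" "C \<in> nsets X r"
    "A \<inter> B = {}" "B \<inter> C = {}" "A \<inter> C = {}" "f A" "f C" "\<not> c A B"
  shows "c C B"
  using assms cone[of A C] triangle[of A B C] c_sym[of B C] by metis

text \<open>Two implications in a row, passing through the blue edge from \<open>A\<close> to
  \<open>B'\<close>. \<open>A'\<close> may meet \<open>B\<close>, which is what allows long chains
  on few points.\<close>

lemma transfer:
  assumes "A \<in> nsets X r" "B \<in> nsets X r" "A' \<in> nsets X r" "B' \<in> nsets X r"
    "A \<inter> B = {}" "A \<inter> B' = {}" "B \<inter> B' = {}" "A \<inter> A' = {}" "A' \<inter> B' = {}"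
    "f A" "f A'" "\<not> f B" "\<not> f B'" "c A B"
  shows "c A' B'"
proof (rule blue_edge_step[of A B' A'])
  show "\<not> c A B'" using assms by (intro red_edge_step[of A B B']) auto
qed (use assms in auto)

text \<open>Let \<open>b s A\<close> say that \<open>insert s E\<close> and \<open>A\<close> are joined in red. Three transfers turn \<open>b p A\<close> into
  \<open>b q A'\<close>, where \<open>A'\<close> arises from \<open>A\<close> by one exchange. Two exchanges can have the effect of a single
  one, so \<open>b p\<close> propagates from \<open>A\<close> to all \<open>r\<close>-subsets of \<open>Z\<close>, including the complement of \<open>A\<close>, which is
  impossible.\<close>

lemma two_point:
  assumes E: "E \<in> nsets X (r - 1)" and Z: "Z \<in> nsets X (2 * r)" and EZ: "E \<inter> Z = {}"
    and pq: "p \<in> X" "q \<in> X" "p \<noteq> q" "p \<notin> E" "p \<notin> Z" "q \<notin> E" "q \<notin> Z"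
    and blue: "\<And>S. S \<in> nsets Z r \<Longrightarrow> \<not> f S" "\<And>n. n \<in> Z \<Longrightarrow> \<not> f (insert n E)"
  shows False
proof -
  have fin: "finite E" "finite Z" "card E = r - 1" "card Z = 2 * r" "E \<subseteq> X" "Z \<subseteq> X"
    using E Z by (auto simp: nsets_def)
  have sub: "S \<in> nsets X r" if "S \<in> nsets Z r" for S
    using that fin by (auto simp: nsets_def)
  have insE: "insert n E \<in> nsets X r" if "n \<in> Z \<or> n = p \<or> n = q" for n
    using that fin pq EZ r by (auto simp: nsets_def card_insert_if)
  have compl: "Z - S \<in> nsets Z r" if "S \<in> nsets Z r" for S
    using that fin by (auto simp: nsets_def card_Diff_subset)
  have insF: "insert s F \<in> nsets X r" if "F \<in> nsets Z (r - 1)" "s = p \<or> s = q" for s F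
    using that fin pq r by (auto simp: nsets_def card_insert_if)
  \<comment> \<open>Otherwise it forms a blue triple with two complementary \<open>r\<close>-subsets
    of \<open>Z\<close>.\<close>
  have redE: "f (insert s E)" if s: "s = p \<or> s = q" for s
  proof (rule ccontr)
    assume nf: "\<not> f (insert s E)"
    obtain S where S: "S \<in> nsets Z r"
      using ex_nsets[of Z r] fin by auto
    show False
      by (rule link_no_mono[of "insert s E" S "Z - S"])
        (use nf blue(1)[OF S] blue(1)[OF compl[OF S]] insE[of s] s sub[OF S] sub[OF compl[OF S]]
          pq EZ nsets_subset[OF S] in auto)
  qed
  have redF: "f (insert s F)" if F: "F \<in> nsets Z (r - 1)" and s: "s = p \<or> s = q" for s F
  proof (rule ccontr)
    assume nf: "\<not> f (insert s F)"
    have card: "card (Z - F) = r + 1" using F fin r by (auto simp: nsets_def card_Diff_subset)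
    then have "Z - F \<noteq> {}" by force
    then obtain n where n: "n \<in> Z" "n \<notin> F" by blast
    have S: "Z - F - {n} \<in> nsets Z r"
      using n card fin by (auto simp: nsets_def)
    show False
      by (rule link_no_mono[of "insert s F" "insert n E" "Z - F - {n}"])
        (use nf blue(2)[of n] blue(1)[OF S] insF[OF F s] insE[of n] sub[OF S] n s pq EZ
          nsets_subset[OF F] in auto)
  qed
  \<comment> \<open>The three transfers are split into one (\<open>half1\<close>) and two
    (\<open>half2\<close>), because the final contradiction enters the chain after the
    first.\<close>
  have half1: "c (insert t F) (insert b F')"
    if st: "(s = p \<and> t = q) \<or> (s = q \<and> t = p)"
      and F: "F \<in> nsets Z (r - 1)" "insert a F \<in> nsets Z r" "insert b F' \<in> nsets Z r"
      and disj: "insert a F \<inter> insert b F' = {}"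
      and c: "c (insert s E) (insert a F)" for s t a b F F'
    by (rule transfer[OF insE[of s] sub[OF F(2)] insF[OF F(1)] sub[OF F(3)]])
      (use c st pq EZ disj redE redF[OF F(1)] blue(1)[OF F(2)] blue(1)[OF F(3)]
        nsets_subset[OF F(2)] nsets_subset[OF F(3)] in auto)
  have half2: "c (insert t E) (insert b F)"
    if st: "(s = p \<and> t = q) \<or> (s = q \<and> t = p)"
      and F: "F \<in> nsets Z (r - 1)" "F' \<in> nsets Z (r - 1)"
        "insert b F' \<in> nsets Z r" "insert b F \<in> nsets Z r"
      and disj: "F \<inter> insert b F' = {}" "b \<notin> F'" "a \<in> Z" "a \<notin> F" "a \<notin> insert b F'"
      and c: "c (insert t F) (insert b F')" for s t a b F F'
  proof -
    have st': "s = p \<or> s = q" "t = p \<or> t = q" using st by auto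
    have b: "b \<in> Z" "b \<notin> F" using F disj by (auto simp: nsets_def)
    have "c (insert s F') (insert a E)"
      by (rule transfer[OF insF[OF F(1) st'(2)] sub[OF F(3)] insF[OF F(2) st'(1)] insE[of a]])
        (use c st pq EZ disj redF[OF F(1) st'(2)] redF[OF F(2) st'(1)] blue(1)[OF F(3)] blue(2)[of a]
          nsets_subset[OF F(1)] nsets_subset[OF F(3)] in auto)
    then show ?thesis
      by (rule transfer[OF insF[OF F(2) st'(1)] insE[of a] insE[of t] sub[OF F(4)], rotated -1])
        (use b st st' pq EZ disj redF[OF F(2) st'(1)] redE[OF st'(2)] blue(1)[OF F(4)] blue(2)[of a]
          nsets_subset[OF F(1)] nsets_subset[OF F(2)] in auto)
  qed
  have exchange: "c (insert t E) (insert b (A - {a}))"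
    if st: "(s = p \<and> t = q) \<or> (s = q \<and> t = p)"
      and A: "A \<in> nsets Z r" "a \<in> A" "b \<in> Z" "b \<notin> A" and c: "c (insert s E) A" for s t A a b
  proof -
    let ?F = "A - {a}" and ?F' = "Z - A - {b}"
    have F: "?F \<in> nsets Z (r - 1)" using A by (auto simp: nsets_def)
    have F': "?F' \<in> nsets Z (r - 1)" using compl[OF A(1)] A by (auto simp: nsets_def)
    have eq: "insert a A = A" "insert b (Z - A) = Z - A" using A by auto
    have "c (insert t ?F) (insert b ?F')"
      by (rule half1[OF st F, of a]) (use A c compl[OF A(1)] in \<open>auto simp: eq\<close>)
    moreover have "insert b ?F \<in> nsets Z r"
      using F A r by (auto simp: nsets_def card_insert_if)
    ultimately show ?thesis
      by (intro half2[OF st F F', of b a]) (use A compl[OF A(1)] nsets_subset[OF A(1)] in \<open>auto simp: eq\<close>)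
  qed
  have move: "c (insert p E) C"
    if A: "A \<in> nsets Z r" "C \<in> nsets Z r" and c: "c (insert p E) A" for A C
    using A c
  proof (rule nsets_exchange_induct[where P = "\<lambda>A. c (insert p E) A"])
    fix A a b assume *: "A \<in> nsets Z r" "c (insert p E) A" "a \<in> A" "b \<in> Z" "b \<notin> A"
    \<comment> \<open>Exchanging \<open>a\<close> for \<open>b'\<close> and then \<open>b'\<close>
      for \<open>b\<close> amounts to exchanging \<open>a\<close> for \<open>b\<close> and leads
      from \<open>p\<close> to \<open>q\<close> and back. The spare point \<open>b'\<close> exists
      because \<open>2 \<le> r\<close>.\<close>
    have "card (Z - A - {b}) = r - 1" using compl[OF *(1)] * by (auto simp: nsets_def)
    with r have "card (Z - A - {b}) \<noteq> 0" by simp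
    then have "Z - A - {b} \<noteq> {}" by (metis card.empty)
    then obtain b' where b': "b' \<in> Z" "b' \<notin> A" "b' \<noteq> b" by blast
    let ?A = "insert b' (A - {a})"
    have A': "?A \<in> nsets Z r" using * b' r by (auto simp: nsets_def card_insert_if card_Diff_singleton)
    have "c (insert q E) ?A" using exchange[of p q A a b'] * b' by auto
    then have "c (insert p E) (insert b (?A - {b'}))"
      using exchange[of q p ?A b' b] A' * b' by auto
    moreover have "?A - {b'} = A - {a}" using b' by auto
    ultimately show "c (insert p E) (insert b (A - {a}))" by simp
  qed
  have all_blue: "\<not> c (insert p E) A" if A: "A \<in> nsets Z r" for A
  proof
    assume "c (insert p E) A"
    moreover have "\<not> c (insert p E) (Z - A)"
      by (rule red_edge_step[OF insE[of p] sub[OF A] sub[OF compl[OF A]]])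
        (use calculation pq EZ blue(1)[OF A] blue(1)[OF compl[OF A]] nsets_subset[OF A] in auto)
    ultimately show False using move[OF A compl[OF A]] by blast
  qed
  have "r - 1 \<le> card Z" using fin(4) by linarith
  then obtain F where F: "F \<in> nsets Z (r - 1)" using ex_nsets[OF fin(2)] by blast
  have "card (Z - F) = r + 1" using F fin r by (auto simp: nsets_def card_Diff_subset)
  then have "Z - F \<noteq> {}" by force
  then obtain b where b: "b \<in> Z" "b \<notin> F" by blast
  have bF: "insert b F \<in> nsets Z r" using F b r by (auto simp: nsets_def card_insert_if)
  let ?B = "Z - insert b F"
  have B: "?B \<in> nsets Z r" by (rule compl[OF bF])
  then have "?B \<noteq> {}" using r by (intro nsets_nonempty) auto
  then obtain a where a: "a \<in> Z" "a \<noteq> b" "a \<notin> F" by blast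
  let ?F' = "?B - {a}"
  have F': "?F' \<in> nsets Z (r - 1)" using B a by (auto simp: nsets_def)
  have bF': "insert b ?F' \<in> nsets Z r" using F' b r by (auto simp: nsets_def card_insert_if)
  have eq: "insert a ?F' = ?B" using a b by auto
  \<comment> \<open>The blue edge from \<open>insert p E\<close> to \<open>insert b ?F'\<close>
    starts the chain in its middle; the chain then ends in a red edge at \<open>insert p E\<close>,
    against \<open>all_blue\<close>.\<close>
  have "c (insert q F) (insert b ?F')"
    by (rule blue_edge_step[OF insE[of p] sub[OF bF'] insF[OF F]])
      (use all_blue[OF bF'] redE redF[OF F] blue(1)[OF bF'] pq EZ b F' nsets_subset[OF F]
        nsets_subset[OF bF'] in auto)
  then have "c (insert q E) (insert b F)"
    by (intro half2[of p q F ?F' b a]) (use a b F F' bF bF' in auto)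
  then have "c (insert p E) (insert a (insert b F - {b}))"
    by (intro exchange[of q p]) (use a b bF in auto)
  moreover have "insert a (insert b F - {b}) \<in> nsets Z r"
    using a b F r by (auto simp: nsets_def card_insert_if)
  ultimately show False using all_blue by blast
qed

end

section \<open>Colour flips and dictatorships\<close>

locale cone_flip = cone_colouring X r f c
  for X :: "'a set" and r f c +
  fixes E :: "'a set" and u v :: 'a and W :: "'a set"
  assumes E: "E \<in> nsets X (r - 1)" and W: "W \<in> nsets X (2 * r)" and EW: "E \<inter> W = {}"
    and uv: "u \<in> X" "v \<in> X" "u \<noteq> v" "u \<notin> E" "v \<notin> E" "u \<notin> W" "v \<notin> W"
    and fu: "f (insert u E)" and fv: "\<not> f (insert v E)"
begin

lemma swap_flip: "cone_flip X r (\<lambda>A. \<not> f A) (\<lambda>A B. \<not> c A B) E v u W"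
  using swap E W EW uv fu fv by (simp add: cone_flip_def cone_flip_axioms_def)

lemma fin: "finite E" "card E = r - 1" "E \<subseteq> X" "finite W" "card W = 2 * r" "W \<subseteq> X"
  using E W by (auto simp: nsets_def)

lemma insert_nsets:
  assumes "D \<in> nsets X (r - 1)" "x \<in> X" "x \<notin> D"
  shows "insert x D \<in> nsets X r"
  using assms r by (auto simp: nsets_def card_insert_if)

lemma W_nsets: "S \<in> nsets W k \<Longrightarrow> S \<in> nsets X k"
  using fin by (auto simp: nsets_def)

lemma W_compl: "S \<in> nsets W r \<Longrightarrow> W - S \<in> nsets W r"
  using fin by (auto simp: nsets_def card_Diff_subset)

lemma uv_nsets: "insert u E \<in> nsets X r" "insert v E \<in> nsets X r"
  using insert_nsets E uv by auto

lemma antipodal_W: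
  assumes "S \<in> nsets W r"
  shows "f (W - S) = (\<not> f S)"
  by (rule antipodal[OF uv_nsets W_nsets[OF assms] W_nsets[OF W_compl[OF assms]]])
    (use fu fv uv EW nsets_subset[OF assms] in auto)

text \<open>Here \<open>S\<close> and \<open>S'\<close> are the differently coloured sets of
  \<open>antipodal\<close>, applied to the disjoint pair \<open>insert v E\<close>,
  \<open>insert u D\<close> and to the same pair with \<open>u\<close> and \<open>v\<close>
  interchanged.\<close>

lemma mixed_pair:
  assumes D: "D \<in> nsets W (r - 1)" and S: "S \<in> nsets (W - D) r" "S' \<in> nsets (W - D) r" "f S \<noteq> f S'"
  shows "f (insert u D)" "\<not> f (insert v D)"
proof -
  have DS: "D \<subseteq> W" "S \<subseteq> W - D" "S' \<subseteq> W - D" using D S nsets_subset by blast+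
  have S': "S \<in> nsets W r" "S' \<in> nsets W r" using S by (auto simp: nsets_def)
  have "f (insert u D) = (\<not> f (insert v E))"
    by (rule antipodal[OF W_nsets[OF S'(1)] W_nsets[OF S'(2)] uv_nsets(2) insert_nsets[OF W_nsets[OF D]]])
      (use S(3) DS uv EW in auto)
  with fv show "f (insert u D)" by simp
  have "f (insert v D) = (\<not> f (insert u E))"
    by (rule antipodal[OF W_nsets[OF S'(1)] W_nsets[OF S'(2)] uv_nsets(1) insert_nsets[OF W_nsets[OF D]]])
      (use S(3) DS uv EW in auto)
  with fu show "\<not> f (insert v D)" by simp
qed

text \<open>\<open>insert n E\<close> and \<open>?K\<close> are disjoint from each other and from
  both the red \<open>insert u D\<close> and the blue \<open>insert v D\<close>, so their colours
  differ; \<open>antipodal_W\<close> turns \<open>?K\<close> into \<open>insert n D\<close>. The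
  left side does not depend on \<open>D\<close>.\<close>

lemma mixed_link:
  assumes D: "D \<in> nsets W (r - 1)" and S: "S \<in> nsets (W - D) r" "S' \<in> nsets (W - D) r" "f S \<noteq> f S'"
    and n: "n \<in> W" "n \<notin> D"
  shows "f (insert n E) = f (insert n D)"
proof -
  let ?K = "W - insert n D"
  have DW: "D \<subseteq> W" using D nsets_subset by blast
  have nD: "insert n D \<in> nsets W r" using D n r by (auto simp: nsets_def card_insert_if)
  have K: "?K \<in> nsets X r" by (rule W_nsets[OF W_compl[OF nD]])
  have nE: "insert n E \<in> nsets X r" using n EW E fin by (intro insert_nsets) auto
  have uD: "insert u D \<in> nsets X r" "insert v D \<in> nsets X r"
    using uv D DW W_nsets by (auto intro!: insert_nsets)
  have "\<not> (f (insert n E) \<and> f ?K)"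
    using link_no_mono[OF nE K uD(1)] mixed_pair(1)[OF D S] DW EW uv n by auto
  moreover have "\<not> (\<not> f (insert n E) \<and> \<not> f ?K)"
    using link_no_mono[OF nE K uD(2)] mixed_pair(2)[OF D S] DW EW uv n by auto
  ultimately show ?thesis using antipodal_W[OF nD] by blast
qed

text \<open>Replacing \<open>a\<close> by \<open>v\<close> in \<open>W\<close> gives a set with only
  blue \<open>r\<close>-subsets, so \<open>two_point\<close> applies with \<open>u\<close> and
  \<open>a\<close> as the two spare points.\<close>

lemma no_red_dictator:
  assumes a: "a \<in> W" and dict: "\<And>S. S \<in> nsets W r \<Longrightarrow> f S = (a \<in> S)"
  shows False
proof -
  let ?Z = "insert v (W - {a})"
  \<comment> \<open>\<open>W - D\<close> has \<open>r + 1\<close> points including \<open>a\<close>: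
    omitting \<open>a\<close> leaves a blue set, omitting any other point a red one.\<close>
  have mixed: "\<exists>S S'. S \<in> nsets (W - D) r \<and> S' \<in> nsets (W - D) r \<and> f S \<noteq> f S'"
    if D: "D \<in> nsets W (r - 1)" "a \<notin> D" for D
  proof -
    have card: "card (W - D) = r + 1" using D fin r by (auto simp: nsets_def card_Diff_subset)
    then have S': "W - D - {a} \<in> nsets (W - D) r"
      using a D fin by (auto simp: nsets_def)
    then have "W - D - {a} \<noteq> {}" using r by (intro nsets_nonempty) auto
    then obtain k where k: "k \<in> W" "k \<notin> D" "k \<noteq> a" by blast
    have S: "W - D - {k} \<in> nsets (W - D) r"
      using k card fin by (auto simp: nsets_def)
    moreover have "W - D - {k} \<in> nsets W r" "W - D - {a} \<in> nsets W r"
      using S S' by (auto simp: nsets_def)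
    ultimately show ?thesis using S' dict k D a by blast
  qed
  show False
  proof (rule two_point[OF E])
    show "?Z \<in> nsets X (2 * r)" using fin a uv r by (auto simp: nsets_def card_insert_if)
    show "u \<in> X" "a \<in> X" "u \<noteq> a" "u \<notin> E" "u \<notin> ?Z" "a \<notin> E" "a \<notin> ?Z" "E \<inter> ?Z = {}"
      using uv a fin EW by auto
    show "\<not> f S" if S: "S \<in> nsets ?Z r" for S
    proof (cases "v \<in> S")
      case True
      then have D: "S - {v} \<in> nsets W (r - 1)" "a \<notin> S - {v}" using S uv by (auto simp: nsets_def)
      from mixed[OF this] mixed_pair(2)[OF D(1)] True show ?thesis by (metis insert_Diff)
    next
      case False
      then have "S \<in> nsets W r" "a \<notin> S" using S uv a by (auto simp: nsets_def)
      with dict show ?thesis by blast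
    qed
    show "\<not> f (insert n E)" if n: "n \<in> ?Z" for n
    proof (cases "n = v")
      case True
      with fv show ?thesis by simp
    next
      case False
      have "r - 1 \<le> card (W - {a, n})" using fin a n False r by (auto simp: card_Diff_subset)
      moreover have "finite (W - {a, n})" using fin by simp
      ultimately obtain D where D: "D \<in> nsets (W - {a, n}) (r - 1)" using ex_nsets by blast
      then have D': "D \<in> nsets W (r - 1)" "a \<notin> D" "n \<notin> D" by (auto simp: nsets_def)
      have nD: "insert n D \<in> nsets W r" using D' n False r by (auto simp: nsets_def card_insert_if)
      obtain S S' where "S \<in> nsets (W - D) r" "S' \<in> nsets (W - D) r" "f S \<noteq> f S'"
        using mixed[OF D'(1,2)] by blast
      from mixed_link[OF D'(1) this, of n] n False D' dict[OF nD] show ?thesis by auto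
    qed
  qed
qed

lemma no_dictator:
  assumes "a \<in> W" "\<And>S. S \<in> nsets W r \<Longrightarrow> f S = (k = (a \<in> S))"
  shows False
proof (cases k)
  case True
  with assms no_red_dictator[of a] show False by auto
next
  case False
  interpret s: cone_flip X r "\<lambda>A. \<not> f A" "\<lambda>A B. \<not> c A B" E v u W by (rule swap_flip)
  show False using s.no_red_dictator[of a] assms False by auto
qed

end

text \<open>Without a flip every exchange preserves the colour, so \<open>f\<close> is constant, yet
  \<open>X\<close> has room for three disjoint \<open>r\<close>-sets.\<close>

lemma (in cone_colouring) ex_flip:
  assumes X: "finite X" "card X = 3 * r + 1"
  shows "\<exists>E u v W. cone_flip X r f c E u v W"
proof (rule ccontr)
  assume no: "\<not> ?thesis"
  have "r \<le> card X" using X by simp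
  then obtain A where A: "A \<in> nsets X r" using ex_nsets X by blast
  have const: "f B = f A" if "B \<in> nsets X r" for B
    using A that
  proof (rule nsets_exchange_induct[where P = "\<lambda>B. f B = f A"])
    fix A' a b assume *: "A' \<in> nsets X r" "f A' = f A" "a \<in> A'" "b \<in> X" "b \<notin> A'"
    let ?E = "A' - {a}" and ?W = "X - insert b A'"
    have E: "?E \<in> nsets X (r - 1)" using * by (auto simp: nsets_def)
    have W: "?W \<in> nsets X (2 * r)"
      using * X by (auto simp: nsets_def card_Diff_subset card_insert_if)
    have A': "insert a ?E = A'" using * by auto
    show "f (insert b ?E) = f A"
    proof (rule ccontr)
      assume "f (insert b ?E) \<noteq> f A"
      then have "f A' \<noteq> f (insert b ?E)" using * by simp
      then have "cone_flip X r f c ?E a b ?W \<or> cone_flip X r f c ?E b a ?W"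
        using cone_colouring_axioms E W * A' nsets_subset[OF *(1)]
        by (auto simp: cone_flip_def cone_flip_axioms_def)
      with no show False by blast
    qed
  qed simp
  have "r \<le> card (X - A)" using A X by (auto simp: nsets_def card_Diff_subset)
  then obtain B where B: "B \<in> nsets (X - A) r" using ex_nsets X by blast
  have "r \<le> card (X - A - B)" using A B X by (auto simp: nsets_def card_Diff_subset)
  then obtain C where C: "C \<in> nsets (X - A - B) r" using ex_nsets[of "X - A - B"] X by blast
  have BC: "B \<in> nsets X r" "C \<in> nsets X r" using B C by (auto simp: nsets_def)
  show False
    using link_no_mono[OF A BC] nsets_subset[OF A] nsets_subset[OF B] nsets_subset[OF C]
      const[OF BC(1)] const[OF BC(2)] by auto
qed

text \<open>The implication cycle was found by breadth-first search.\<close>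

lemma (in cone_colouring) five_five_chain:
  assumes r3: "r = 3" and X: "{t1, t2, t3, t4, t5, w1, w2, w3, w4, w5} \<subseteq> X"
    and dist: "distinct [t1, t2, t3, t4, t5, w1, w2, w3, w4, w5]"
    and red: "f {t1, t2, w1}" "f {t3, t5, w2}" "f {t2, t4, w4}" "f {t1, t3, w1}" "f {t2, t5, w5}" "f {t3, t4, w3}"
    and blue: "\<not> f {t3, w2, w3}" "\<not> f {t4, w4, w5}" "\<not> f {t1, w1, w3}" "\<not> f {t5, w2, w5}" "\<not> f {t4, w3, w4}" "\<not> f {t1, w1, w2}" "\<not> f {t5, w4, w5}"
  shows "\<not> c {t1, t2, w1} {t3, w2, w3}"
proof
  assume "c {t1, t2, w1} {t3, w2, w3}"
  then have "c {t3, t5, w2} {t4, w4, w5}"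
    by (rule transfer[rotated -1]) (use X dist red blue in \<open>auto simp: r3 mem_nsets\<close>)
  then have "c {t2, t4, w4} {t1, w1, w3}"
    by (rule transfer[rotated -1]) (use X dist red blue in \<open>auto simp: r3 mem_nsets\<close>)
  then have "c {t1, t3, w1} {t5, w2, w5}"
    by (rule transfer[rotated -1]) (use X dist red blue in \<open>auto simp: r3 mem_nsets\<close>)
  then have "c {t2, t5, w5} {t4, w3, w4}"
    by (rule transfer[rotated -1]) (use X dist red blue in \<open>auto simp: r3 mem_nsets\<close>)
  then have "c {t3, t4, w3} {t1, w1, w2}"
    by (rule transfer[rotated -1]) (use X dist red blue in \<open>auto simp: r3 mem_nsets\<close>)
  then have "c {t1, t2, w1} {t5, w4, w5}"
    by (rule transfer[rotated -1]) (use X dist red blue in \<open>auto simp: r3 mem_nsets\<close>)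
  \<comment> \<open>The cycle returns to \<open>{t1, t2, w1}\<close>, which cannot be joined in red
    to two disjoint blue sets.\<close>
  then have "\<not> c {t1, t2, w1} {t3, w2, w3}"
    by (rule red_edge_step[rotated -1]) (use X dist blue in \<open>auto simp: r3 mem_nsets\<close>)
  with \<open>c {t1, t2, w1} {t3, w2, w3}\<close> show False by blast
qed

section \<open>The cases r = 2 and r = 3\<close>

text \<open>If the three pairs through \<open>a\<close> agree, \<open>a\<close> is a dictator;
  otherwise one of them differs from the other two, and by antipodality its other end is a
  dictator.\<close>

lemma (in cone_flip) rank_two_False:
  assumes r2: "r = 2"
  shows False
proof -
  have "card W = 4" using fin r2 by simp
  then obtain xs where xs: "set xs = W" "distinct xs" "length xs = Suc (Suc (Suc (Suc 0)))"
    using finite_distinct_list[OF fin(4)] distinct_card by fastforce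
  then obtain a b d e where We: "W = {a, b, d, e}" and dist: "distinct [a, b, d, e]"
    by (auto simp: length_Suc_conv)
  have anti: "f {d, e} = (\<not> f {a, b})" "f {b, e} = (\<not> f {a, d})" "f {b, d} = (\<not> f {a, e})"
    using antipodal_W[of "{a, b}"] antipodal_W[of "{a, d}"] antipodal_W[of "{a, e}"] dist
    by (auto simp: We r2 mem_nsets insert_Diff_if insert_commute)
  consider "f {a, d} = f {a, b}" "f {a, e} = f {a, b}" | "f {a, d} = f {a, b}" "f {a, e} \<noteq> f {a, b}"
    | "f {a, e} = f {a, b}" "f {a, d} \<noteq> f {a, b}" | "f {a, d} = f {a, e}" "f {a, e} \<noteq> f {a, b}"
    by blast
  then show False
  proof cases
    case 1
    show False
      by (rule no_dictator[of a "f {a, b}"]) (use 1 anti dist in \<open>auto simp: We r2 nsets_2_eq insert_commute\<close>)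
  next
    case 2
    show False
      by (rule no_dictator[of e "f {a, e}"]) (use 2 anti dist in \<open>auto simp: We r2 nsets_2_eq insert_commute\<close>)
  next
    case 3
    show False
      by (rule no_dictator[of d "f {a, d}"]) (use 3 anti dist in \<open>auto simp: We r2 nsets_2_eq insert_commute\<close>)
  next
    case 4
    show False
      by (rule no_dictator[of b "f {a, b}"]) (use 4 anti dist in \<open>auto simp: We r2 nsets_2_eq insert_commute\<close>)
  qed
qed

text \<open>For a pair \<open>D\<close> whose complement in \<open>W\<close> contains triples of
  both colours, \<open>mixed_link\<close> supplies the common \<open>t\<close>; for the other pairs
  antipodality makes the colour constant.\<close>

lemma (in cone_flip) majority:
  assumes r3: "r = 3"
  shows "\<exists>T\<in>nsets W 3. \<forall>S\<in>nsets W 3. f S = (2 \<le> card (S \<inter> T))"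
proof -
  have "\<exists>T\<in>nsets W 3. \<forall>D\<in>nsets T 2. \<forall>n\<in>W - D. f (insert n D)"
  proof (rule six_point)
    show "card W = 6" using fin r3 by simp
    show anti: "f (W - S) = (\<not> f S)" if "S \<in> nsets W 3" for S
      using antipodal_W that r3 by blast
    have ins: "insert n D \<in> nsets W 3" if "D \<in> nsets W 2" "n \<in> W - D" for n D
      using that by (auto simp: nsets_def card_insert_if)
    show "(\<exists>k. \<forall>n\<in>W - D. f (insert n D) = k) \<or> (\<forall>n\<in>W - D. f (insert n D) = f (insert n E))"
      if D: "D \<in> nsets W 2" for D
    proof (cases "\<exists>S S'. S \<in> nsets (W - D) r \<and> S' \<in> nsets (W - D) r \<and> f S \<noteq> f S'")
      case True
      then show ?thesis using mixed_link[of D] D r3 by auto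
    next
      case False
      have K: "W - insert n D \<in> nsets (W - D) r" "f (insert n D) = (\<not> f (W - insert n D))"
        if "n \<in> W - D" for n
        using anti[OF ins[OF D that]] ins[OF D that] fin r3 by (auto simp: nsets_def card_Diff_subset)
      have "f (insert n D) = f (insert m D)" if "n \<in> W - D" "m \<in> W - D" for n m
        using K[OF that(1)] K[OF that(2)] False by blast
      then show ?thesis by blast
    qed
    show "\<exists>D\<in>nsets (W - {a}) 2. f (insert a D) \<noteq> k" if a: "a \<in> W" for a k
    proof (rule ccontr)
      assume no: "\<not> ?thesis"
      have *: "f S = k" if "S \<in> nsets W 3" "a \<in> S" for S
      proof -
        have "S - {a} \<in> nsets (W - {a}) 2" using that by (auto simp: nsets_def)
        then show ?thesis using no that by (metis insert_Diff)
      qed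
      show False
      proof (rule no_dictator[OF a])
        fix S assume S: "S \<in> nsets W r"
        show "f S = (k = (a \<in> S))"
          using *[of S] *[of "W - S"] W_compl[OF S] S antipodal_W[OF S] a r3 by auto
      qed
    qed
  qed
  then obtain T where T: "T \<in> nsets W 3" and *: "\<And>D n. \<lbrakk>D \<in> nsets T 2; n \<in> W - D\<rbrakk> \<Longrightarrow> f (insert n D)"
    by blast
  have red: "f S" if S: "S \<in> nsets W 3" "2 \<le> card (S \<inter> T)" for S
  proof -
    obtain D where D: "D \<in> nsets (S \<inter> T) 2"
      using ex_nsets[of "S \<inter> T" 2] S by (auto simp: nsets_def)
    then have DT: "D \<in> nsets T 2" "D \<subseteq> S" by (auto simp: nsets_def)
    then have "card (S - D) = 1" using S by (auto simp: nsets_def card_Diff_subset)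
    then obtain n where "S - D = {n}" by (auto simp: card_1_singleton_iff)
    then have "n \<in> W - D" "S = insert n D" using DT S by (auto simp: nsets_def)
    then show ?thesis using *[OF DT(1)] by blast
  qed
  \<comment> \<open>If \<open>S\<close> has at most one point of \<open>T\<close>, its complement
    has at least two and is red, so \<open>S\<close> is blue.\<close>
  have "f S = (2 \<le> card (S \<inter> T))" if S: "S \<in> nsets W 3" for S
  proof (cases "2 \<le> card (S \<inter> T)")
    case False
    have "card T = card (S \<inter> T) + card (T - S)"
      using T card_Un_disjoint[of "S \<inter> T" "T - S"] Un_Diff_Int[of T S]
      by (simp add: nsets_def Int_commute Un_commute Diff_Int_distrib2 Int_Diff)
    moreover have "(W - S) \<inter> T = T - S" using T by (auto simp: nsets_def)
    ultimately have "f (W - S)" using red[of "W - S"] False T W_compl S r3 by (auto simp: nsets_def)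
    then show ?thesis using antipodal_W S r3 False by blast
  qed (use red S in blast)
  with T show ?thesis by blast
qed

text \<open>A second flip, \<open>{i', j'}\<close> with \<open>i''\<close> and \<open>j''\<close>,
  has \<open>{x, y, u, v, i, j}\<close> as its complement, so \<open>majority\<close> applies there
  too. Since \<open>{i, x, y}\<close> and \<open>{u, x, y}\<close> are red and
  \<open>{v, x, y}\<close> is blue, its majority set contains \<open>u\<close>, \<open>i\<close> and
  exactly one of \<open>x\<close>, \<open>y\<close>.\<close>

lemma (in cone_flip) second_majority:
  assumes r3: "r = 3" and Exy: "E = {x, y}" "x \<noteq> y"
    and We: "W = {i, i', i'', j, j', j''}" and dist: "distinct [i, i', i'', j, j', j'']"
    and maj: "\<And>S. S \<in> nsets W 3 \<Longrightarrow> f S = (2 \<le> card (S \<inter> {i, i', i''}))"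
  shows "\<exists>w\<in>{x, y}. \<forall>S\<in>nsets {x, y, u, v, i, j} 3. f S = (2 \<le> card (S \<inter> {u, i, w}))"
proof -
  have X: "{x, y, u, v, i, i', i'', j, j', j''} \<subseteq> X" using fin uv Exy We by auto
  have d: "distinct [x, y, u, v, i, i', i'', j, j', j'']"
    using dist Exy EW uv by (auto simp: We)
  have f1: "f {i'', i', j'}" "\<not> f {j'', i', j'}" "f {i, i', j}" "f {i, i'', j'}" "\<not> f {i'', j', j''}"
    using maj dist by (auto simp: We mem_nsets card_insert_if)
  interpret s: cone_flip X r f c "{i', j'}" i'' j'' "{x, y, u, v, i, j}"
    by unfold_locales (use X d f1 r3 in \<open>auto simp: nsets_def\<close>)
  obtain T where T: "T \<in> nsets {x, y, u, v, i, j} 3"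
    and fT: "\<And>S. S \<in> nsets {x, y, u, v, i, j} 3 \<Longrightarrow> f S = (2 \<le> card (S \<inter> T))"
    using s.majority[OF r3] by blast
  have "f (insert i E) = f (insert i {i', j})"
    by (rule mixed_link[of _ "{i, i'', j'}" "{i'', j', j''}"])
      (use f1 d in \<open>auto simp: r3 We mem_nsets\<close>)
  then have "f {i, x, y}" "f {u, x, y}" "\<not> f {v, x, y}"
    using f1 fu fv Exy by (auto simp: insert_commute)
  then have "u \<in> T" "i \<in> T" "(x \<in> T) \<noteq> (y \<in> T)"
    using fT d by (auto simp: mem_nsets card_insert_if Int_insert_left split: if_splits)
  then obtain w where w: "w \<in> {x, y}" "{u, i, w} \<subseteq> T" by auto
  moreover have "card {u, i, w} = 3" using d w by auto
  ultimately have "{u, i, w} = T" using T by (intro card_subset_eq) (auto simp: nsets_def)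
  with fT w show ?thesis by blast
qed

lemma (in cone_flip) rank_three_False:
  assumes r3: "r = 3"
  shows False
proof -
  obtain T where T: "T \<in> nsets W 3" and fT: "\<And>S. S \<in> nsets W 3 \<Longrightarrow> f S = (2 \<le> card (S \<inter> T))"
    using majority[OF r3] by blast
  have card: "card T = 3" "card (W - T) = 3" using T fin r3 by (auto simp: nsets_def card_Diff_subset)
  obtain i1 i2 i3 where Te: "T = {i1, i2, i3}" and di: "i1 \<noteq> i2" "i1 \<noteq> i3" "i2 \<noteq> i3"
    using card(1) unfolding card_3_iff by blast
  obtain j1 j2 j3 where Ue: "W - T = {j1, j2, j3}" and dj: "j1 \<noteq> j2" "j1 \<noteq> j3" "j2 \<noteq> j3"
    using card(2) unfolding card_3_iff by blast
  note d0 = di dj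
  have "W = T \<union> (W - T)" using T by (auto simp: nsets_def)
  also have "\<dots> = {i1, i2, i3, j1, j2, j3}" unfolding Ue unfolding Te by auto
  finally have We: "W = {i1, i2, i3, j1, j2, j3}" .
  have "{j1, j2, j3} \<inter> {i1, i2, i3} = {}" using Te Ue by auto
  with d0 have d1: "distinct [i1, i2, i3, j1, j2, j3]" by auto
  have sm: "\<exists>w\<in>{x, y}. \<forall>S\<in>nsets {x, y, u, v, i, j} 3. f S = (2 \<le> card (S \<inter> {u, i, w}))"
    if "E = {x, y}" "x \<noteq> y" "i \<in> T" "j \<in> W - T" for x y i j
  proof -
    obtain i' i'' where "T = {i, i', i''}" "distinct [i, i', i'']"
      using \<open>i \<in> T\<close> d0 unfolding Te by fastforce
    moreover obtain j' j'' where "W - T = {j, j', j''}" "distinct [j, j', j'']"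
      using \<open>j \<in> W - T\<close> d0 unfolding Ue by fastforce
    moreover have "{i, i', i''} \<inter> {j, j', j''} = {}" "W = {i, i', i'', j, j', j''}"
      using calculation T by (auto simp: nsets_def)
    ultimately show ?thesis
      using second_majority[OF r3 that(1,2), of i i' i'' j j' j''] fT by auto
  qed
  \<comment> \<open>The colour of \<open>{x, u, v}\<close> involves neither \<open>i\<close> nor
    \<open>j\<close>, so it selects the same \<open>w\<close> for all of them. When it is red,
    \<open>{u, x, i1, i2, i3}\<close> is the distinguished 5-set.\<close>
  have main: False if Exy: "E = {x, y}" "x \<noteq> y" and fx: "f {x, u, v}" for x y
  proof -
    have d: "distinct [x, y, u, v, i1, i2, i3, j1, j2, j3]"
      using d1 Exy EW uv by (auto simp: We)
    have X: "{x, y, u, v, i1, i2, i3, j1, j2, j3} \<subseteq> X" using fin uv Exy We by auto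
    have dij: "distinct [x, y, u, v, i, j]" if "i \<in> T" "j \<in> W - T" for i j
    proof -
      have "i \<in> {i1, i2, i3}" "j \<in> {j1, j2, j3}" using that unfolding Ue unfolding Te by auto
      then show ?thesis using d by auto
    qed
    have F: "f S = (2 \<le> card (S \<inter> {u, i, x}))"
      if ij: "i \<in> T" "j \<in> W - T" and S: "S \<in> nsets {x, y, u, v, i, j} 3" for i j S
    proof -
      obtain w where w: "w \<in> {x, y}"
        "\<And>S. S \<in> nsets {x, y, u, v, i, j} 3 \<Longrightarrow> f S = (2 \<le> card (S \<inter> {u, i, w}))"
        using sm[OF Exy ij] by blast
      have "w \<noteq> y"
      proof
        assume "w = y"
        moreover have "f {x, u, v} = (2 \<le> card ({x, u, v} \<inter> {u, i, w}))"
          by (rule w(2)) (use dij[OF ij] in \<open>auto simp: mem_nsets\<close>)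
        ultimately show False
          using fx dij[OF ij] by (auto simp: card_insert_if Int_insert_left)
      qed
      then have "w = x" using w(1) by blast
      with w(2)[OF S] show ?thesis by simp
    qed
    \<comment> \<open>\<open>G\<close> lists the triples of the two chains that are not inside
      \<open>W\<close>, in the element order used there; \<open>H\<close> covers those inside
      \<open>W\<close>.\<close>
    have G: "f {i, u, y}" "f {x, i, v}" "f {u, i, j}" "f {i, x, y}" "f {x, i, j}"
      "\<not> f {x, v, j}" "\<not> f {i, y, j}" "\<not> f {i, v, j}" "\<not> f {i, y, v}"
      "\<not> f {j, v, x}" "\<not> f {y, j, u}" "\<not> f {v, j, i}" "\<not> f {j, y, x}" "\<not> f {y, j, i}"
      "f {y, u, i}" "f {j, x, i}" "f {j, u, i}" "f {j, x, u}"
      if "i \<in> T" "j \<in> W - T" for i j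
    proof -
      show "f {i, u, y}" "f {x, i, v}" "f {u, i, j}" "f {i, x, y}" "f {x, i, j}"
        "\<not> f {x, v, j}" "\<not> f {i, y, j}" "\<not> f {i, v, j}" "\<not> f {i, y, v}"
        "\<not> f {j, v, x}" "\<not> f {y, j, u}" "\<not> f {v, j, i}" "\<not> f {j, y, x}" "\<not> f {y, j, i}"
        "f {y, u, i}" "f {j, x, i}" "f {j, u, i}" "f {j, x, u}"
        using dij[OF that] by (auto simp: F[OF that] mem_nsets card_insert_if Int_insert_left)
    qed
    have H: "f {j, i, i'}" "\<not> f {i, j, j'}"
      if "i \<in> T" "i' \<in> T" "i \<noteq> i'" "j \<in> W - T" "j' \<in> W - T" "j \<noteq> j'" for i i' j j'
    proof -
      have "i \<in> W" "i' \<in> W" "j \<noteq> i" "j \<noteq> i'" "j' \<noteq> i" using that T by (auto simp: nsets_def)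
      then show "f {j, i, i'}" "\<not> f {i, j, j'}"
        using that fT[of "{j, i, i'}"] fT[of "{i, j, j'}"] by (auto simp: mem_nsets Int_insert_left)
    qed
    have iT: "i1 \<in> T" "i2 \<in> T" "i3 \<in> T" "j1 \<in> W - T" "j2 \<in> W - T" "j3 \<in> W - T"
      unfolding Ue unfolding Te by auto
    \<comment> \<open>The chain for the first 5-set makes this edge blue; the colour-swapped chain
      for \<open>{j1, v, y, j2, j3}\<close> makes the same edge red.\<close>
    have "\<not> c {i1, u, y} {x, v, j1}"
      by (rule five_five_chain[OF r3, of i1 u x i2 i3 y v j1 j2 j3])
        (use X d iT G H in auto)
    moreover
    interpret s: cone_colouring X r "\<lambda>A. \<not> f A" "\<lambda>A B. \<not> c A B" by (rule swap)
    have "\<not> \<not> c {j1, v, x} {y, u, i1}"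
      by (rule s.five_five_chain[OF r3, of j1 v y j2 j3 x u i1 i2 i3])
        (use X d iT G H in auto)
    ultimately show False using c_sym by (simp add: insert_commute)
  qed
  have "card E = 2" using fin r3 by simp
  then obtain x y where Exy: "E = {x, y}" "x \<noteq> y" by (auto simp: card_2_iff)
  have "i1 \<in> T" "j1 \<in> W - T" unfolding Ue unfolding Te by auto
  then obtain w where w: "w \<in> {x, y}"
    "\<forall>S\<in>nsets {x, y, u, v, i1, j1} 3. f S = (2 \<le> card (S \<inter> {u, i1, w}))"
    using sm[OF Exy] by blast
  then have "f {w, u, v}" using Exy uv by (auto simp: mem_nsets card_insert_if)
  then show False using main[of x y] main[of y x] Exy w by (auto simp: insert_commute)
qed

section \<open>From cliques to disjoint triples\<close>

text \<open>For \<open>0 < r\<close> disjoint sets are distinct, so three pairwise disjoint sets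
  really form a 3-element clique.\<close>

lemma clique_three_iff:
  assumes "0 < r"
  shows "has_mono_clique (kneser_verts n r) (kneser_edges n r) c k 3 \<longleftrightarrow>
    (\<exists>A B C. {A, B, C} \<subseteq> nsets {1..n} r \<and> A \<inter> B = {} \<and> B \<inter> C = {} \<and> A \<inter> C = {} \<and>
      c {A, B} = k \<and> c {B, C} = k \<and> c {A, C} = k)" (is "?L \<longleftrightarrow> ?R")
proof
  have edge: "{A, B} \<in> kneser_edges n r \<longleftrightarrow>
      A \<in> nsets {1..n} r \<and> B \<in> nsets {1..n} r \<and> A \<noteq> B \<and> A \<inter> B = {}" for A B
    by (auto simp: kneser_edges_def kneser_verts_def doubleton_eq_iff)
  show ?R if ?L
  proof -
    from that obtain K where K: "K \<subseteq> nsets {1..n} r" "card K = 3"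
      and cl: "clique K {e \<in> kneser_edges n r. c e = k}"
      by (auto simp: has_mono_clique_def kneser_verts_def)
    then obtain A B C where "K = {A, B, C}" "A \<noteq> B" "A \<noteq> C" "B \<noteq> C"
      unfolding card_3_iff by blast
    with K cl show ?R by (intro exI[of _ A] exI[of _ B] exI[of _ C]) (simp add: clique_def edge)
  qed
  show ?L if ?R
  proof -
    from that obtain A B C where ABC: "{A, B, C} \<subseteq> nsets {1..n} r" "A \<inter> B = {}" "B \<inter> C = {}" "A \<inter> C = {}"
      "c {A, B} = k" "c {B, C} = k" "c {A, C} = k" by blast
    then have "A \<noteq> {}" "B \<noteq> {}" "C \<noteq> {}" using ABC(1) assms by (meson insert_subset nsets_nonempty)+
    with ABC have ne: "A \<noteq> B" "A \<noteq> C" "B \<noteq> C" by auto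
    define F where "F = {e \<in> kneser_edges n r. c e = k}"
    have "{A, B} \<in> F" "{B, C} \<in> F" "{A, C} \<in> F"
      using ABC ne by (simp_all add: F_def edge)
    then have cl: "clique {A, B, C} F"
      by (auto simp: clique_def insert_commute)
    have sub: "{A, B, C} \<subseteq> kneser_verts n r" using ABC(1) by (simp add: kneser_verts_def)
    have fin: "finite {A, B, C}" and card: "card {A, B, C} = 3" using ne by simp_all
    show ?L
      unfolding has_mono_clique_def F_def[symmetric]
      by (intro exI[of _ "{A, B, C}"] conjI sub fin card cl)
  qed
qed

lemma kneser_arrows_three_iff:
  assumes "0 < r"
  shows "kneser_arrows n r 3 3 \<longleftrightarrow>
    (\<forall>c :: nat set set \<Rightarrow> colour. \<exists>A B C. {A, B, C} \<subseteq> nsets {1..n} r \<and>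
      A \<inter> B = {} \<and> B \<inter> C = {} \<and> A \<inter> C = {} \<and> c {A, B} = c {B, C} \<and> c {B, C} = c {A, C})"
proof -
  have mono: "\<exists>A B C. {A, B, C} \<subseteq> nsets {1..n} r \<and> A \<inter> B = {} \<and> B \<inter> C = {} \<and> A \<inter> C = {} \<and>
      c {A, B} = c {B, C} \<and> c {B, C} = c {A, C}"
    if "{A, B, C} \<subseteq> nsets {1..n} r" "A \<inter> B = {}" "B \<inter> C = {}" "A \<inter> C = {}"
      "c {A, B} = k" "c {B, C} = k" "c {A, C} = k" for c :: "nat set set \<Rightarrow> colour" and A B C k
    using that by (intro exI[of _ A] exI[of _ B] exI[of _ C]) simp
  show ?thesis
    unfolding kneser_arrows_def clique_three_iff[OF assms]
  proof (intro iff_allI iffI; (elim disjE exE conjE)?)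
    fix c :: "nat set set \<Rightarrow> colour" and A B C
    assume *: "{A, B, C} \<subseteq> nsets {1..n} r" "A \<inter> B = {}" "B \<inter> C = {}" "A \<inter> C = {}"
      "c {A, B} = c {B, C}" "c {B, C} = c {A, C}"
    then show "(\<exists>A B C. {A, B, C} \<subseteq> nsets {1..n} r \<and> A \<inter> B = {} \<and> B \<inter> C = {} \<and> A \<inter> C = {} \<and>
        c {A, B} = Red \<and> c {B, C} = Red \<and> c {A, C} = Red) \<or>
      (\<exists>A B C. {A, B, C} \<subseteq> nsets {1..n} r \<and> A \<inter> B = {} \<and> B \<inter> C = {} \<and> A \<inter> C = {} \<and>
        c {A, B} = Blue \<and> c {B, C} = Blue \<and> c {A, C} = Blue)"
    proof (cases "c {A, B}")
      case Red
      with * have "c {A, B} = Red" "c {B, C} = Red" "c {A, C} = Red" by simp_all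
      with *(1-4) show ?thesis by blast
    next
      case Blue
      with * have "c {A, B} = Blue" "c {B, C} = Blue" "c {A, C} = Blue" by simp_all
      with *(1-4) show ?thesis by blast
    qed
  qed (rule mono; assumption)+
qed

text \<open>Removing the points of \<open>P\<close> leaves the \<open>3 * r + 1\<close> points
  required by \<open>ex_flip\<close>; only the last step depends on the value of
  \<open>r\<close>.\<close>

lemma kneser_arrows_cone:
  assumes r23: "r = 2 \<or> r = 3"
  shows "kneser_arrows (4 * r + 1) r 3 3"
proof (rule ccontr)
  assume "\<not> ?thesis"
  moreover have "0 < r" using r23 by auto
  ultimately obtain c :: "nat set set \<Rightarrow> colour" where
    c0: "\<not> (\<exists>A B C. {A, B, C} \<subseteq> nsets {1..4 * r + 1} r \<and> A \<inter> B = {} \<and> B \<inter> C = {} \<and> A \<inter> C = {} \<and>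
      c {A, B} = c {B, C} \<and> c {B, C} = c {A, C})"
    unfolding kneser_arrows_three_iff[OF \<open>0 < r\<close>] by blast
  have c: "\<not> (c {A, B} = c {B, C} \<and> c {B, C} = c {A, C})"
    if "A \<in> nsets {1..4 * r + 1} r" "B \<in> nsets {1..4 * r + 1} r" "C \<in> nsets {1..4 * r + 1} r"
      "A \<inter> B = {}" "B \<inter> C = {}" "A \<inter> C = {}" for A B C
    using c0 that by blast
  define X where "X = {r + 1..4 * r + 1}"
  define P where "P = {1..r}"
  have P: "P \<in> nsets {1..4 * r + 1} r" by (auto simp: P_def nsets_def)
  have X: "A \<in> nsets {1..4 * r + 1} r" "P \<inter> A = {}" if "A \<in> nsets X r" for A
    using that by (auto simp: P_def X_def nsets_def)
  have red: "c e = c e' \<longleftrightarrow> (c e = Red \<longleftrightarrow> c e' = Red)" for e e'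
    by (metis colour.exhaust)
  interpret cone_colouring X r "\<lambda>A. c {P, A} = Red" "\<lambda>A B. c {A, B} = Red"
  proof
    show "2 \<le> r" using r23 by auto
    show "(c {A, B} = Red) = (c {B, A} = Red)" for A B by (simp add: insert_commute)
    show "(c {A, B} = Red) = (c {P, A} \<noteq> Red)"
      if "A \<in> nsets X r" "B \<in> nsets X r" "A \<inter> B = {}" "(c {P, A} = Red) = (c {P, B} = Red)" for A B
      using c[OF P X(1)[OF that(1)] X(1)[OF that(2)]] X(2)[OF that(1)] X(2)[OF that(2)] that(3,4)
      unfolding red by blast
    show "\<not> ((c {A, B} = Red) = (c {B, C} = Red) \<and> (c {B, C} = Red) = (c {A, C} = Red))"
      if "A \<in> nsets X r" "B \<in> nsets X r" "C \<in> nsets X r" "A \<inter> B = {}" "B \<inter> C = {}" "A \<inter> C = {}" for A B C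
      using c[OF X(1)[OF that(1)] X(1)[OF that(2)] X(1)[OF that(3)] that(4-6)] unfolding red by blast
  qed
  have "finite X" "card X = 3 * r + 1" by (auto simp: X_def)
  from ex_flip[OF this] obtain E u v W
    where "cone_flip X r (\<lambda>A. c {P, A} = Red) (\<lambda>A B. c {A, B} = Red) E u v W" by blast
  then interpret flip: cone_flip X r "\<lambda>A. c {P, A} = Red" "\<lambda>A B. c {A, B} = Red" E u v W .
  from r23 show False using flip.rank_two_False flip.rank_three_False by (rule disjE)
qed

section \<open>The pentagon colouring of KG(8, 2)\<close>

definition next_vertex :: "nat \<Rightarrow> nat" where
  "next_vertex x = (if x = 8 then 4 else Suc x)"

text \<open>The arguments are the traces of two vertices on \<open>{4..8}\<close>; a trace of size
  0, 1 or 2 tells an inner, mixed or pentagon pair.\<close>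

definition pentagon_red :: "nat set \<Rightarrow> nat set \<Rightarrow> bool" where
  "pentagon_red A B \<longleftrightarrow> A = {} \<and> card B = 2 \<or> (\<exists>x. A = {x} \<and> next_vertex x \<in> B)"

definition pentagon_edge :: "nat set \<Rightarrow> nat set \<Rightarrow> bool" where
  "pentagon_edge A B \<longleftrightarrow> pentagon_red A B \<or> pentagon_red B A"

lemma pentagon_edge_simps:
  "pentagon_edge A B = pentagon_edge B A"
  "pentagon_edge {} B = (card B = 2)"
  "pentagon_edge {x} {y} \<longleftrightarrow> next_vertex x = y \<or> next_vertex y = x"
  "card B = 2 \<Longrightarrow> pentagon_edge {x} B \<longleftrightarrow> next_vertex x \<in> B"
  "card A = 2 \<Longrightarrow> card B = 2 \<Longrightarrow> \<not> pentagon_edge A B"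
  by (auto simp: pentagon_edge_def pentagon_red_def)

lemma pentagon_edge_ordered:
  assumes P: "A \<subseteq> {4..8}" "B \<subseteq> {4..8}" "C \<subseteq> {4..8}" "A \<inter> B = {}" "B \<inter> C = {}" "A \<inter> C = {}"
    and card: "card A \<le> card B" "card B \<le> card C" "card C \<le> 2" "3 \<le> card A + card B + card C"
  shows "\<not> (pentagon_edge A B = pentagon_edge B C \<and> pentagon_edge B C = pentagon_edge A C)"
proof -
  have fin: "finite A" "finite B" "finite C" using P by (auto intro: finite_subset)
  have "card (A \<union> B \<union> C) = card A + card B + card C"
    using fin P by (simp add: card_Un_disjoint Int_Un_distrib2)
  moreover have "card (A \<union> B \<union> C) \<le> card {4..8::nat}" using P by (intro card_mono) auto
  ultimately have sum: "card A + card B + card C \<le> 5" by simp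
  then consider "card A = 0" "card C = 2" "card B = 1 \<or> card B = 2" | "card A = 1" "card B = 1" "card C = 1"
    | "card A = 1" "card B = 1" "card C = 2" | "card A = 1" "card B = 2" "card C = 2"
    using card by linarith
  then show ?thesis
  proof cases
    case 1
    with fin show ?thesis by (auto simp: pentagon_edge_simps(2,5))
  next
    case 2
    then obtain x y z where e: "A = {x}" "B = {y}" "C = {z}" by (auto simp: card_1_singleton_iff)
    then have "x \<in> {4, 5, 6, 7, 8}" "y \<in> {4, 5, 6, 7, 8}" "z \<in> {4, 5, 6, 7, 8}" using P by auto
    \<comment> \<open>A 5-cycle has neither a triangle nor three independent vertices.\<close>
    with P(4-6) show ?thesis
      unfolding e pentagon_edge_simps(3) next_vertex_def by (elim insertE) simp_all
  next
    case 3
    then obtain x y where e: "A = {x}" "B = {y}" by (auto simp: card_1_singleton_iff)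
    have ne: "x \<noteq> y" "x \<notin> C" "y \<notin> C" using P e by auto
    have xy: "x \<in> {4, 5, 6, 7, 8}" "y \<in> {4, 5, 6, 7, 8}" using P e by auto
    show ?thesis
    proof
      assume *: "pentagon_edge A B = pentagon_edge B C \<and> pentagon_edge B C = pentagon_edge A C"
      \<comment> \<open>All red is impossible: one of \<open>x\<close>, \<open>y\<close> would be
        the successor of the other and so would have to lie in \<open>C\<close>. If all are blue,
        both points and both successors avoid \<open>C\<close>, which leaves only three
        points.\<close>
      then have no: "next_vertex x \<noteq> y" "next_vertex y \<noteq> x" "next_vertex x \<notin> C" "next_vertex y \<notin> C"
        using ne 3(3) unfolding e by (auto simp: pentagon_edge_simps(3,4))
      have "card {x, y, next_vertex x, next_vertex y} = 4"
        using xy ne(1) no(1,2) by (elim insertE) (simp_all add: next_vertex_def)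
      moreover have "{x, y, next_vertex x, next_vertex y} \<subseteq> {4..8} - C"
        using xy ne no by (auto simp: next_vertex_def)
      ultimately have "4 \<le> card ({4..8} - C)" by (metis card_mono finite_Diff finite_atLeastAtMost)
      then show False using 3(3) P(3) fin by (simp add: card_Diff_subset)
    qed
  next
    case 4
    then obtain x where e: "A = {x}" by (auto simp: card_1_singleton_iff)
    \<comment> \<open>The successor of \<open>x\<close> must lie in \<open>B\<close> or
      \<open>C\<close>, giving a red edge, while the edge between the two pairs is blue.\<close>
    have "A \<union> B \<union> C = {4..8}"
      using 4 \<open>card (A \<union> B \<union> C) = _\<close> P by (intro card_subset_eq) auto
    moreover have nx: "next_vertex x \<in> {4..8}" "next_vertex x \<notin> A" using P e by (auto simp: next_vertex_def)
    ultimately have "next_vertex x \<in> A \<union> B \<union> C" by blast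
    with nx have "next_vertex x \<in> B \<union> C" by blast
    then show ?thesis using 4 P(5) unfolding e by (auto simp: pentagon_edge_simps(4,5))
  qed
qed

lemma pentagon_edge_not_mono:
  assumes P: "A \<subseteq> {4..8}" "B \<subseteq> {4..8}" "C \<subseteq> {4..8}" "A \<inter> B = {}" "B \<inter> C = {}" "A \<inter> C = {}"
    and card: "card A \<le> 2" "card B \<le> 2" "card C \<le> 2" "3 \<le> card A + card B + card C"
  shows "\<not> (pentagon_edge A B = pentagon_edge B C \<and> pentagon_edge B C = pentagon_edge A C)"
proof -
  have P': "B \<inter> A = {}" "C \<inter> B = {}" "C \<inter> A = {}" using P by auto
  have s: "pentagon_edge B A = pentagon_edge A B" "pentagon_edge C B = pentagon_edge B C"
    "pentagon_edge C A = pentagon_edge A C" by (rule pentagon_edge_simps(1))+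
  consider "card A \<le> card B" "card B \<le> card C" | "card A \<le> card C" "card C \<le> card B"
    | "card B \<le> card A" "card A \<le> card C" | "card B \<le> card C" "card C \<le> card A"
    | "card C \<le> card A" "card A \<le> card B" | "card C \<le> card B" "card B \<le> card A"
    by linarith
  then show ?thesis
  proof cases
    case 1 with pentagon_edge_ordered[of A B C] P P' card s show ?thesis by simp
  next
    case 2 with pentagon_edge_ordered[of A C B] P P' card s show ?thesis by auto
  next
    case 3 with pentagon_edge_ordered[of B A C] P P' card s show ?thesis by auto
  next
    case 4 with pentagon_edge_ordered[of B C A] P P' card s show ?thesis by auto
  next
    case 5 with pentagon_edge_ordered[of C A B] P P' card s show ?thesis by auto
  next
    case 6 with pentagon_edge_ordered[of C B A] P P' card s show ?thesis by auto
  qed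
qed

text \<open>The three sets have six points in total, of which at most three lie outside
  \<open>{4..8}\<close>.\<close>

lemma pentagon_part_card:
  assumes "A \<in> nsets {1..8} 2" "B \<in> nsets {1..8} 2" "C \<in> nsets {1..8} 2" "A \<inter> B = {}" "B \<inter> C = {}" "A \<inter> C = {}"
  shows "3 \<le> card (A \<inter> {4..8}) + card (B \<inter> {4..8}) + card (C \<inter> {4..8::nat})"
proof -
  have fin: "finite A" "finite B" "finite C" "card A = 2" "card B = 2" "card C = 2"
    using assms by (auto simp: nsets_def)
  let ?U = "A \<union> B \<union> C"
  have "card ?U = 6" using fin assms by (simp add: card_Un_disjoint Int_Un_distrib2)
  moreover have "card ?U \<le> card ({1, 2, 3} \<union> (?U \<inter> {4..8}))"
    using assms fin by (intro card_mono) (auto simp: nsets_def)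
  moreover have "card ({1, 2, 3} \<union> (?U \<inter> {4..8})) \<le> 3 + card (?U \<inter> {4..8})"
    by (rule order_trans[OF card_Un_le]) (simp add: card_insert_if)
  moreover have "card (?U \<inter> {4..8}) \<le> card (A \<inter> {4..8}) + card (B \<inter> {4..8}) + card (C \<inter> {4..8})"
    unfolding Int_Un_distrib2 by (meson add_right_mono card_Un_le order_trans)
  ultimately show ?thesis by linarith
qed

lemma not_kneser_arrows_eight: "\<not> kneser_arrows 8 2 3 3"
proof -
  \<comment> \<open>The symmetry of \<open>pentagon_edge\<close> makes the colour independent of the
    order in which the edge is written.\<close>
  define c where "c e = (if \<exists>A B. e = {A, B} \<and> pentagon_edge (A \<inter> {4..8}) (B \<inter> {4..8}) then Red else Blue)" for e
  have c: "c {A, B} = Red \<longleftrightarrow> pentagon_edge (A \<inter> {4..8}) (B \<inter> {4..8})" for A B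
    using pentagon_edge_simps(1) by (auto simp: c_def doubleton_eq_iff)
  have "\<not> (c {A, B} = c {B, C} \<and> c {B, C} = c {A, C})"
    if ABC: "{A, B, C} \<subseteq> nsets {1..8} 2" "A \<inter> B = {}" "B \<inter> C = {}" "A \<inter> C = {}" for A B C
  proof -
    have le: "card (S \<inter> {4..8}) \<le> 2" if "S \<in> nsets {1..8} 2" for S :: "nat set"
      using that by (metis (mono_tags, lifting) Int_lower1 card_mono mem_Collect_eq nsets_def)
    have "\<not> (pentagon_edge (A \<inter> {4..8}) (B \<inter> {4..8}) = pentagon_edge (B \<inter> {4..8}) (C \<inter> {4..8}) \<and>
        pentagon_edge (B \<inter> {4..8}) (C \<inter> {4..8}) = pentagon_edge (A \<inter> {4..8}) (C \<inter> {4..8}))"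
      using ABC le pentagon_part_card[of A B C] by (intro pentagon_edge_not_mono) auto
    then have "\<not> ((c {A, B} = Red) = (c {B, C} = Red) \<and> (c {B, C} = Red) = (c {A, C} = Red))"
      unfolding c .
    then show ?thesis by auto
  qed
  moreover have "0 < (2::nat)" by simp
  ultimately show ?thesis unfolding kneser_arrows_three_iff[OF \<open>0 < 2\<close>] by blast
qed

section \<open>Monotonicity and the two bounds\<close>

text \<open>Needed for the lower bound: failure at 8 must rule out every smaller \<open>n\<close> as
  well.\<close>

lemma kneser_arrows_mono:
  assumes "kneser_arrows m r 3 3" "m \<le> n" "0 < r"
  shows "kneser_arrows n r 3 3"
proof -
  have sub: "nsets {1..m} r \<subseteq> nsets {1..n} r" using assms(2) by (intro nsets_mono) auto
  show ?thesis
    unfolding kneser_arrows_three_iff[OF assms(3)]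
  proof
    fix c :: "nat set set \<Rightarrow> colour"
    obtain A B C where *: "{A, B, C} \<subseteq> nsets {1..m} r \<and> A \<inter> B = {} \<and> B \<inter> C = {} \<and>
        A \<inter> C = {} \<and> c {A, B} = c {B, C} \<and> c {B, C} = c {A, C}"
      using assms(1)[unfolded kneser_arrows_three_iff[OF assms(3)], THEN spec[of _ c]] by (elim exE)
    have "{A, B, C} \<subseteq> nsets {1..n} r" using *[THEN conjunct1] sub by (rule order_trans)
    then show "\<exists>A B C. {A, B, C} \<subseteq> nsets {1..n} r \<and> A \<inter> B = {} \<and> B \<inter> C = {} \<and> A \<inter> C = {} \<and>
        c {A, B} = c {B, C} \<and> c {B, C} = c {A, C}"
      using *[THEN conjunct2] by (intro exI[of _ A] exI[of _ B] exI[of _ C] conjI) (elim conjE; assumption)+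
  qed
qed

theorem theorem1p12:
  shows "kneser_ramsey 2 3 3 = 9 \<and> kneser_ramsey 3 3 3 \<le> 13"
proof
  show "kneser_ramsey 2 3 3 = 9"
    unfolding kneser_ramsey_def
  proof (rule Least_equality)
    show "kneser_arrows 9 2 3 3" using kneser_arrows_cone[of 2] by simp
    show "9 \<le> n" if "kneser_arrows n 2 3 3" for n
      using kneser_arrows_mono[OF that, of 8] not_kneser_arrows_eight by (cases "n \<le> 8") auto
  qed
  show "kneser_ramsey 3 3 3 \<le> 13"
    unfolding kneser_ramsey_def using kneser_arrows_cone[of 3] by (intro Least_le) simp
qed

end
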